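(* Fix a finite presentation $G=\langle a_1,\dots,a_d\mid r_1,\dots,r_q\rangle$ and let $M=2d+q$ be the number of its law terms. Let $D_{G,w}(n)$ be the dispersion of the instance associated to $G$ and $w$, as defined in the context. For every nonempty signed word $w$ of length $L$ (the number of letters as written, without cancellation) and every integer $n>L$, $$ n(n-1)-Mn\le D_{G,w}(n)\le n(n-1).$$ An interpretation on an $n$-element alphabet whose allowed output image has at least $n(n-1)-Mn$ elements is explicitly computable and uses only cyclic shifts (every function symbol is interpreted as a cyclic shift of the alphabet). In particular, for each such word $w$, $$\lim_{n\to\infty}\frac{D_{G,w}(n)}{n(n-1)}=1,\qquad D_{G,w}(n)=n^2-O_G(n),$$ where the constant in the error bound depends only on the presentation, while the condition $n>L$ also depends on the word. (The lower bound is an integer inequality and may be negative.)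
   Context: Signed words are finite sequences $v=\ell_1\cdots\ell_L$ of letters from $\{a_1^{\pm1},\dots,a_d^{\pm1}\}$, not assumed freely reduced; the relators $r_j$ are signed words. For each generator $a_i$ introduce two unary function symbols $p_i,m_i$. An interpretation on a set $A$ assigns to each of these $2d$ symbols an arbitrary function $A\to A$ (in particular $p_i,m_i$ need not be interpreted as inverse functions). For a signed word $v=\ell_1\cdots\ell_L$ define the term $\tau_v(x)=f_{\ell_1}(f_{\ell_2}(\cdots f_{\ell_L}(x)\cdots))$, where $f_{a_i}=p_i$, $f_{a_i^{-1}}=m_i$, and $\tau_v(x)=x$ for the empty word $v$. The list $\mathcal L_G$ of law terms consists of the $M=2d+q$ terms $p_i(m_i(x))$, $m_i(p_i(x))$ for $1\le i\le d$ and $\tau_{r_j}(x)$ for $1\le j\le q$ (repetitions retained). The instance associated to $G,w$ has the two variables $x,y$, output tuple $(x,y)$, and the tests $x\ne y$; $L(x)\ne y$ for each $L\in\mathcal L_G$; $\tau_w(x)\ne x$. For an interpretation on a finite set $A$, the allowed output image is the set of pairs $(a,b)\in A^2$ which satisfy all these tests when $x=a$, $y=b$. For $n\ge1$, $D_{G,w}(n)$ is the maximum of the cardinality of this set over all interpretations on an $n$-element set. A cyclic shift is a map of the form $z\mapsto z+c$ on $\mathbb Z/n\mathbb Z$. *)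

theory Defs
  imports Complex_Main "HOL-Library.FuncSet" "HOL-Library.Nat_Bijection"
begin

section \<open>Signed words and presentations\<close>

text \<open>\<open>Pos i\<close> is the letter $a_i$ and \<open>Neg i\<close> the letter $a_i^{-1}$. Words are plain lists and are
  never freely reduced. A finite presentation with generators $a_1,\dots,a_d$ is given by \<open>d\<close>
  and the list of its relators; both may be empty.\<close>

datatype letter = Pos nat | Neg nat

type_synonym word = "letter list"

definition letters :: "nat \<Rightarrow> letter set" where
  "letters d = Pos ` {1..d} \<union> Neg ` {1..d}"

definition signed_word :: "nat \<Rightarrow> word \<Rightarrow> bool" where
  "signed_word d v \<longleftrightarrow> set v \<subseteq> letters d"

definition finite_presentation :: "nat \<Rightarrow> word list \<Rightarrow> bool" where
  "finite_presentation d rels \<longleftrightarrow> (\<forall>r \<in> set rels. signed_word d r)"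

section \<open>Terms and interpretations\<close>

text \<open>\<open>PSym i\<close> and \<open>MSym i\<close> are the unary function symbols $p_i$ and $m_i$.\<close>

datatype fsym = PSym nat | MSym nat

datatype var = X | Y

datatype trm = Var var | App fsym trm

definition symbols :: "nat \<Rightarrow> fsym set" where
  "symbols d = PSym ` {1..d} \<union> MSym ` {1..d}"

fun letter_sym :: "letter \<Rightarrow> fsym" where
  "letter_sym (Pos i) = PSym i"
| "letter_sym (Neg i) = MSym i"

fun word_term :: "word \<Rightarrow> trm" where
  "word_term [] = Var X"
| "word_term (l # v) = App (letter_sym l) (word_term v)"

text \<open>An interpretation on a carrier \<open>A\<close> matters only through the values of the $2d$ symbols on \<open>A\<close>;
  no relation between the two functions belonging to the same generator is imposed.\<close>

definition is_interpretation :: "nat \<Rightarrow> 'a set \<Rightarrow> (fsym \<Rightarrow> 'a \<Rightarrow> 'a) \<Rightarrow> bool" where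
  "is_interpretation d A I \<longleftrightarrow> (\<forall>s \<in> symbols d. I s \<in> A \<rightarrow> A)"

fun eval_term :: "(fsym \<Rightarrow> 'a \<Rightarrow> 'a) \<Rightarrow> 'a \<Rightarrow> 'a \<Rightarrow> trm \<Rightarrow> 'a" where
  "eval_term I a b (Var X) = a"
| "eval_term I a b (Var Y) = b"
| "eval_term I a b (App s t) = I s (eval_term I a b t)"

section \<open>The instance of a presentation and a word, and its dispersion\<close>

definition law_terms :: "nat \<Rightarrow> word list \<Rightarrow> trm list" where
  "law_terms d rels =
     concat (map (\<lambda>i. [App (PSym i) (App (MSym i) (Var X)), App (MSym i) (App (PSym i) (Var X))])
       [1..<Suc d])
     @ map word_term rels"

lemma length_law_terms: "length (law_terms d rels) = 2 * d + length rels"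
  by (simp add: law_terms_def length_concat o_def sum_list_triv)

text \<open>A pair \<open>(s, t)\<close> stands for the test $s \neq t$.\<close>

definition tests :: "nat \<Rightarrow> word list \<Rightarrow> word \<Rightarrow> (trm \<times> trm) list" where
  "tests d rels w =
     (Var X, Var Y) # map (\<lambda>t. (t, Var Y)) (law_terms d rels) @ [(word_term w, Var X)]"

definition allowed_image ::
    "nat \<Rightarrow> word list \<Rightarrow> word \<Rightarrow> 'a set \<Rightarrow> (fsym \<Rightarrow> 'a \<Rightarrow> 'a) \<Rightarrow> ('a \<times> 'a) set" where
  "allowed_image d rels w A I =
     {(a, b) \<in> A \<times> A. \<forall>(s, t) \<in> set (tests d rels w). eval_term I a b s \<noteq> eval_term I a b t}"

text \<open>Every \<open>n\<close>-element set is in bijection with a set of natural numbers, so it is enough to let the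
  carrier range over the latter.\<close>

definition image_sizes :: "nat \<Rightarrow> word list \<Rightarrow> word \<Rightarrow> nat \<Rightarrow> nat set" where
  "image_sizes d rels w n =
     {card (allowed_image d rels w A I) | (A :: nat set) I.
        finite A \<and> card A = n \<and> is_interpretation d A I}"

definition dispersion :: "nat \<Rightarrow> word list \<Rightarrow> word \<Rightarrow> nat \<Rightarrow> nat" where
  "dispersion d rels w n = Max (image_sizes d rels w n)"

lemma image_sizes_finite_nonempty:
  "finite (image_sizes d rels w n)" "image_sizes d rels w n \<noteq> {}"
proof -
  have "card (allowed_image d rels w A I) \<le> n * n" if "finite A" "card A = n"
    for A :: "nat set" and I
  proof -
    have "card (allowed_image d rels w A I) \<le> card (A \<times> A)"
      using that by (intro card_mono) (auto simp: allowed_image_def)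
    then show ?thesis using that by (simp add: card_cartesian_product)
  qed
  then have "image_sizes d rels w n \<subseteq> {..n * n}"
    by (auto simp: image_sizes_def)
  then show "finite (image_sizes d rels w n)"
    by (rule finite_subset) simp
  have "finite {..<n} \<and> card {..<n} = n \<and> is_interpretation d {..<n} (\<lambda>_ z. z)"
    by (simp add: is_interpretation_def)
  then show "image_sizes d rels w n \<noteq> {}"
    unfolding image_sizes_def by blast
qed

section \<open>Cyclic shifts\<close>

text \<open>The ring $\mathbb Z/n\mathbb Z$ is represented by the residues \<open>{..<n}\<close>.\<close>

definition cyclic_shift :: "nat \<Rightarrow> (nat \<Rightarrow> nat) \<Rightarrow> bool" where
  "cyclic_shift n f \<longleftrightarrow> (\<exists>c. \<forall>z < n. f z = (z + c) mod n)"

section \<open>Computable interpretations\<close>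

text \<open>\<open>recursive k f\<close>: on argument lists of length \<open>k\<close>, \<open>f\<close> is a total (general) recursive function in
  the sense of Kleene, where minimisation is applied only to functions that always have a
  zero. Rule \<open>cong\<close> makes the values on lists of any other length irrelevant.\<close>

inductive recursive :: "nat \<Rightarrow> (nat list \<Rightarrow> nat) \<Rightarrow> bool" where
  zero: "recursive k (\<lambda>_. 0)"
| succ: "recursive 1 (\<lambda>xs. Suc (xs ! 0))"
| proj: "i < k \<Longrightarrow> recursive k (\<lambda>xs. xs ! i)"
| comp: "recursive (length gs) f \<Longrightarrow> \<forall>g \<in> set gs. recursive k g \<Longrightarrow>
    recursive k (\<lambda>xs. f (map (\<lambda>g. g xs) gs))"
| prim_rec: "recursive k f \<Longrightarrow> recursive (Suc (Suc k)) g \<Longrightarrow>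
    recursive (Suc k) (\<lambda>xs. rec_nat (f (tl xs)) (\<lambda>m r. g (m # r # tl xs)) (hd xs))"
| minim: "recursive (Suc k) f \<Longrightarrow> \<forall>xs. length xs = k \<longrightarrow> (\<exists>m. f (m # xs) = 0) \<Longrightarrow>
    recursive k (\<lambda>xs. LEAST m. f (m # xs) = 0)"
| cong: "recursive k f \<Longrightarrow> \<forall>xs. length xs = k \<longrightarrow> g xs = f xs \<Longrightarrow> recursive k g"

fun letter_code :: "letter \<Rightarrow> nat" where
  "letter_code (Pos i) = 2 * i"
| "letter_code (Neg i) = 2 * i + 1"

fun sym_code :: "fsym \<Rightarrow> nat" where
  "sym_code (PSym i) = 2 * i"
| "sym_code (MSym i) = 2 * i + 1"

definition word_code :: "word \<Rightarrow> nat" where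
  "word_code v = list_encode (map letter_code v)"

text \<open>A family of interpretations on the alphabets \<open>{..<n}\<close>, indexed by the presentation, the word and
  \<open>n\<close>, is computable if one algorithm, given the presentation, the word, \<open>n\<close>, a function symbol
  and an element of the alphabet, returns the value of that symbol at that element.\<close>

definition computable_interpretations ::
    "(nat \<Rightarrow> word list \<Rightarrow> word \<Rightarrow> nat \<Rightarrow> fsym \<Rightarrow> nat \<Rightarrow> nat) \<Rightarrow> bool" where
  "computable_interpretations J \<longleftrightarrow>
     (\<exists>F. recursive 6 F \<and>
       (\<forall>d rels w n s z. J d rels w n s z =
          F [d, list_encode (map word_code rels), word_code w, n, sym_code s, z]))"

end

theory Submission imports Defs begin

text \<open>The functions interpreting $p_i$ and $m_i$ are independent, so let the symbol of the first
  letter of \<open>w\<close> act as $z \mapsto z + 1$ on $\mathbb Z/n\mathbb Z$ and every other symbol as the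
  identity. Then $\tau_w$ is the shift by the number of occurrences of that letter, which lies
  between $1$ and $L < n$, so the test on \<open>w\<close> always holds. Each of the \<open>M\<close> law tests excludes the
  graph of one function, that is, at most \<open>n\<close> pairs.\<close>

section \<open>Recursive functions\<close>

text \<open>With the \<open>comp\<close> rule specialised to short explicit lists, each arithmetic
  operation need only be shown recursive on projections and can then be applied to arbitrary
  recursive arguments.\<close>

lemma recursive_comp1:
  assumes "recursive 1 f" "recursive k g"
  shows "recursive k (\<lambda>xs. f [g xs])"
  using recursive.comp[of "[g]" f k] assms by simp

lemma recursive_comp2:
  assumes "recursive 2 f" "recursive k g" "recursive k h"
  shows "recursive k (\<lambda>xs. f [g xs, h xs])"
  using recursive.comp[of "[g, h]" f k] assms by (simp add: numeral_2_eq_2)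

lemma recursive_comp3:
  assumes "recursive 3 f" "recursive k g" "recursive k h" "recursive k l"
  shows "recursive k (\<lambda>xs. f [g xs, h xs, l xs])"
  using recursive.comp[of "[g, h, l]" f k] assms by (simp add: numeral_3_eq_3)

lemma recursive_Suc:
  assumes "recursive k g"
  shows "recursive k (\<lambda>xs. Suc (g xs))"
  using recursive_comp1[OF recursive.succ assms] by simp

lemma recursive_prim_rec1:
  assumes "recursive 2 g"
  shows "recursive 1 (\<lambda>xs. rec_nat 0 (\<lambda>m r. g [m, r]) (xs ! 0))"
proof -
  have "recursive 2 (\<lambda>xs. g [xs ! 0, xs ! 1])"
    by (rule recursive_comp2[OF assms]; rule recursive.proj) auto
  then have "recursive (Suc 0) (\<lambda>xs. rec_nat 0 (\<lambda>m r. g [(m # r # tl xs) ! 0, (m # r # tl xs) ! 1]) (hd xs))"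
    by (intro recursive.prim_rec[OF recursive.zero]) (simp add: numeral_2_eq_2)
  then show ?thesis
    unfolding One_nat_def by (rule recursive.cong) (auto simp: length_Suc_conv)
qed

text \<open>Entry 0 is the recursion variable and entry 1 a parameter. Reading entries with
  \<open>!\<close> instead of \<open>hd\<close> and \<open>tl\<close> agrees on lists of length 2,
  which is all that \<open>cong\<close> asks for.\<close>

lemma recursive_prim_rec2:
  assumes "recursive 1 f" "recursive 3 g"
  shows "recursive 2 (\<lambda>xs. rec_nat (f [xs ! 1]) (\<lambda>m r. g [m, r, xs ! 1]) (xs ! 0))"
proof -
  have "recursive (Suc (Suc 0)) (\<lambda>xs. rec_nat (f (tl xs)) (\<lambda>m r. g (m # r # tl xs)) (hd xs))"
    using assms by (intro recursive.prim_rec) (auto simp: numeral_3_eq_3)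
  then show ?thesis
    unfolding numeral_2_eq_2 by (rule recursive.cong) (auto simp: length_Suc_conv)
qed

lemma recursive_add:
  assumes "recursive k g" "recursive k h"
  shows "recursive k (\<lambda>xs. g xs + h xs)"
proof -
  have "rec_nat b (\<lambda>m r. Suc r) a = a + b" for a b
    by (induction a) auto
  moreover have "recursive 2 (\<lambda>xs. rec_nat ((\<lambda>ys. ys ! 0) [xs ! 1])
      (\<lambda>m r. (\<lambda>ys. Suc (ys ! 1)) [m, r, xs ! 1]) (xs ! 0))"
    by (intro recursive_prim_rec2 recursive_Suc recursive.proj) auto
  ultimately have "recursive 2 (\<lambda>xs. xs ! 0 + xs ! 1)"
    by simp
  from recursive_comp2[OF this assms] show ?thesis by simp
qed

lemma recursive_pred:
  assumes "recursive k g"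
  shows "recursive k (\<lambda>xs. g xs - 1)"
proof -
  have "rec_nat 0 (\<lambda>m r. m) a = a - 1" for a :: nat
    by (cases a) auto
  moreover have "recursive 1 (\<lambda>xs. rec_nat 0 (\<lambda>m r. (\<lambda>ys. ys ! 0) [m, r]) (xs ! 0))"
    by (intro recursive_prim_rec1 recursive.proj) auto
  ultimately have "recursive 1 (\<lambda>xs. xs ! 0 - 1)"
    by simp
  from recursive_comp1[OF this assms] show ?thesis by simp
qed

text \<open>Applying the truncated predecessor \<open>a\<close> times to \<open>b\<close> yields
  \<open>b - a\<close>. The recursion thus runs on the subtrahend, and the two arguments are swapped
  at the end.\<close>

lemma recursive_diff:
  assumes "recursive k g" "recursive k h"
  shows "recursive k (\<lambda>xs. g xs - h xs)"
proof -
  have "rec_nat b (\<lambda>m r. r - 1) a = b - a" for a b :: nat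
    by (induction a) auto
  moreover have "recursive 2 (\<lambda>xs. rec_nat ((\<lambda>ys. ys ! 0) [xs ! 1])
      (\<lambda>m r. (\<lambda>ys. ys ! 1 - 1) [m, r, xs ! 1]) (xs ! 0))"
    by (intro recursive_prim_rec2 recursive_pred recursive.proj) auto
  ultimately have "recursive 2 (\<lambda>xs. xs ! 1 - xs ! 0)"
    by simp
  from recursive_comp2[OF this assms(2,1)] show ?thesis by simp
qed

text \<open>A case distinction is a primitive recursion on the condition that ignores the previous
  value: the base returns one branch, every step the other.\<close>

lemma recursive_if_zero:
  assumes "recursive k c" "recursive k g" "recursive k h"
  shows "recursive k (\<lambda>xs. if c xs = 0 then g xs else h xs)"
proof -
  \<comment> \<open>The list \<open>m # r # tl xs\<close> carries the two branches at positions 2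
    and 3, so \<open>ys ! 3\<close> is the nonzero branch.\<close>
  have "recursive (Suc (Suc 1)) (\<lambda>xs. rec_nat ((\<lambda>ys. ys ! 0) (tl xs))
      (\<lambda>m r. (\<lambda>ys. ys ! 3) (m # r # tl xs)) (hd xs))"
    by (intro recursive.prim_rec recursive.proj) auto
  moreover have "rec_nat a (\<lambda>m r. b) n = (if n = 0 then a else b)" for a b n :: nat
    by (cases n) auto
  ultimately have "recursive 3 (\<lambda>xs. if hd xs = 0 then tl xs ! 0 else tl xs ! Suc 0)"
    by (simp add: numeral_3_eq_3)
  then have "recursive 3 (\<lambda>xs. if xs ! 0 = 0 then xs ! 1 else xs ! 2)"
    by (rule recursive.cong) (auto simp: numeral_3_eq_3 length_Suc_conv)
  from recursive_comp3[OF this assms] show ?thesis by (simp cong: if_cong)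
qed

lemma recursive_if_eq:
  assumes "recursive k a" "recursive k b" "recursive k g" "recursive k h"
  shows "recursive k (\<lambda>xs. if a xs = b xs then g xs else h xs)"
proof -
  \<comment> \<open>Both truncated differences vanish exactly when the two values agree.\<close>
  have "recursive k (\<lambda>xs. if (a xs - b xs) + (b xs - a xs) = 0 then g xs else h xs)"
    by (intro recursive_if_zero recursive_add recursive_diff assms)
  moreover have "(a xs - b xs) + (b xs - a xs) = 0 \<longleftrightarrow> a xs = b xs" for xs
    by auto
  ultimately show ?thesis by (simp only:)
qed

section \<open>Triangular numbers and decoding the head of a list code\<close>

lemma recursive_triangle:
  assumes "recursive k g"
  shows "recursive k (\<lambda>xs. triangle (g xs))"
proof -
  have "rec_nat 0 (\<lambda>m r. r + Suc m) a = triangle a" for a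
    by (induction a) auto
  moreover have "recursive 1 (\<lambda>xs. rec_nat 0 (\<lambda>m r. (\<lambda>ys. ys ! 1 + Suc (ys ! 0)) [m, r]) (xs ! 0))"
    by (intro recursive_prim_rec1 recursive_add recursive_Suc recursive.proj) auto
  ultimately have "recursive 1 (\<lambda>xs. triangle (xs ! 0))"
    by simp
  from recursive_comp1[OF this assms] show ?thesis by simp
qed

text \<open>Since \<open>list_encode (x # xs) = Suc (triangle (x + t) + x)\<close> with \<open>t = list_encode xs\<close>, the
  minimisation finds the diagonal \<open>x + t\<close>.\<close>

definition head_code :: "nat \<Rightarrow> nat" where
  "head_code c = c - 1 - triangle (LEAST m. c - triangle (Suc m) = 0)"

lemma triangle_mono: "m \<le> n \<Longrightarrow> triangle m \<le> triangle n"
  by (induction n rule: dec_induct) auto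

text \<open>This bound makes the search in \<open>head_code\<close> succeed on every input.\<close>

lemma le_triangle: "n \<le> triangle n"
  by (induction n) auto

lemma head_code_list_encode: "head_code (list_encode (x # xs)) = x"
proof -
  define s where "s = x + list_encode xs"
  have code: "list_encode (x # xs) = Suc (triangle s + x)"
    by (simp add: s_def prod_encode_def)
  have "(LEAST m. list_encode (x # xs) - triangle (Suc m) = 0) = s"
  proof (rule Least_equality)
    \<comment> \<open>Since \<open>x \<le> s\<close>, the code is at most
      \<open>triangle s + Suc s = triangle (Suc s)\<close>.\<close>
    show "list_encode (x # xs) - triangle (Suc s) = 0"
      unfolding code by (simp add: s_def)
    show "s \<le> m" if "list_encode (x # xs) - triangle (Suc m) = 0" for m
    proof (rule ccontr)
      assume "\<not> s \<le> m"
      \<comment> \<open>The code exceeds \<open>triangle s\<close>, so for \<open>m < s\<close> the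
        truncated difference stays positive.\<close>
      then have "triangle (Suc m) \<le> triangle s"
        by (intro triangle_mono) simp
      with that show False
        unfolding code by simp
    qed
  qed
  then show ?thesis
    unfolding head_code_def by (simp only: code)
qed

lemma recursive_head_code:
  assumes "recursive k g"
  shows "recursive k (\<lambda>xs. head_code (g xs))"
proof -
  have "recursive 1 (\<lambda>xs. LEAST m. (\<lambda>ys. ys ! 1 - triangle (Suc (ys ! 0))) (m # xs) = 0)"
  proof (intro recursive.minim allI impI)
    show "recursive (Suc 1) (\<lambda>ys. ys ! 1 - triangle (Suc (ys ! 0)))"
      by (intro recursive_diff recursive_triangle recursive_Suc recursive.proj) auto
    \<comment> \<open>The rule \<open>minim\<close> requires a zero for every input, including 0,
      the code of the empty list. The input itself is a witness.\<close>
    show "\<exists>m. (m # xs) ! 1 - triangle (Suc ((m # xs) ! 0)) = 0" for xs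
      using le_triangle[of "Suc (xs ! 0)"] by (intro exI[of _ "xs ! 0"]) simp
  qed
  then have "recursive 1 (\<lambda>xs. xs ! 0 - 1 - triangle (LEAST m. xs ! 0 - triangle (Suc m) = 0))"
    by (intro recursive_diff recursive_pred recursive_triangle recursive.proj) auto
  from recursive_comp1[OF this assms] show ?thesis
    by (simp add: head_code_def)
qed

section \<open>Shift interpretations\<close>

lemma sym_code_letter_sym: "sym_code (letter_sym l) = letter_code l"
  by (cases l) auto

text \<open>Composing shifts adds their amounts, so a word acts as the shift by the sum over its
  letters.\<close>

lemma eval_word_term_shift:
  fixes I :: "fsym \<Rightarrow> nat \<Rightarrow> nat"
  assumes "\<And>s z. z < n \<Longrightarrow> I s z = (z + c s) mod n" "a < n"
  shows "eval_term I a b (word_term v) = (a + (\<Sum>l\<leftarrow>v. c (letter_sym l))) mod n"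
proof (induction v)
  case Nil
  then show ?case using assms(2) by simp
next
  case (Cons l v)
  have "eval_term I a b (word_term (l # v)) =
      ((a + (\<Sum>l\<leftarrow>v. c (letter_sym l))) mod n + c (letter_sym l)) mod n"
    using assms by (simp add: Cons)
  then show ?case
    by (simp add: mod_simps ac_simps)
qed

text \<open>Symbols are compared through their codes, and the wrap-around is a test
  \<open>Suc z = n\<close> instead of a \<open>mod\<close>, so that the body is built directly from
  operations already shown recursive.\<close>

definition first_letter_shift ::
    "nat \<Rightarrow> word list \<Rightarrow> word \<Rightarrow> nat \<Rightarrow> fsym \<Rightarrow> nat \<Rightarrow> nat" where
  "first_letter_shift d rels w n s z =
     (if sym_code s = head_code (word_code w) then if Suc z = n then 0 else Suc z else z)"

lemma computable_first_letter_shift: "computable_interpretations first_letter_shift"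
  unfolding computable_interpretations_def
proof (intro exI conjI allI)
  \<comment> \<open>Positions 2 to 5 of the argument list hold the code of the word,
    \<open>n\<close>, the code of the symbol and \<open>z\<close>.\<close>
  show "recursive 6 (\<lambda>xs. if xs ! 4 = head_code (xs ! 2)
      then if Suc (xs ! 5) = xs ! 3 then 0 else Suc (xs ! 5) else xs ! 5)"
    by (intro recursive_if_eq recursive_head_code recursive_Suc recursive.zero recursive.proj) auto
qed (simp add: first_letter_shift_def)

definition head_shift :: "word \<Rightarrow> fsym \<Rightarrow> nat" where
  "head_shift w s = of_bool (sym_code s = head_code (word_code w))"

lemma first_letter_shift_eq:
  assumes "z < n"
  shows "first_letter_shift d rels w n s z = (z + head_shift w s) mod n"
  using assms by (auto simp: first_letter_shift_def head_shift_def)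

lemma word_term_first_letter_shift:
  assumes "w \<noteq> []" "length w < n" "a < n"
  shows "eval_term (first_letter_shift d rels w n) a b (word_term w) \<noteq> a"
proof
  obtain l v where w: "w = l # v"
    using assms(1) by (cases w) auto
  define k where "k = (\<Sum>l\<leftarrow>w. head_shift w (letter_sym l))"
  have "head_code (word_code w) = letter_code l"
    by (simp only: w word_code_def list.map head_code_list_encode)
  then have "head_shift w (letter_sym l) = 1"
    by (simp add: head_shift_def sym_code_letter_sym)
  then have "0 < k"
    by (simp add: k_def) (simp add: w)
  have "k \<le> (\<Sum>l\<leftarrow>w. 1)"
    unfolding k_def by (intro sum_list_mono) (simp add: head_shift_def)
  then have "k < n"
    using assms(2) by (simp add: sum_list_triv)
  assume "eval_term (first_letter_shift d rels w n) a b (word_term w) = a"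
  moreover have "eval_term (first_letter_shift d rels w n) a b (word_term w) = (a + k) mod n"
    unfolding k_def using first_letter_shift_eq assms(3) by (rule eval_word_term_shift)
  ultimately have "(a + k) mod n = a"
    by simp
  then show False
    \<comment> \<open>As \<open>a + k < 2 * n\<close>, the residue is \<open>a + k\<close> or
      \<open>a + k - n\<close>; the first is above \<open>a\<close>, the second below.\<close>
    using \<open>0 < k\<close> \<open>k < n\<close> assms(3) by (cases "a + k < n") (auto simp: le_mod_geq)
qed

section \<open>Counting allowed pairs\<close>

lemma eval_word_term_indep: "eval_term I a b (word_term v) = eval_term I a b' (word_term v)"
  by (induction v) auto

text \<open>Law terms contain only the variable \<open>X\<close>. Hence a law test forbids, for each
  \<open>a\<close>, a single value of \<open>b\<close>, and the forbidden pairs form the graph of a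
  function.\<close>

lemma eval_law_term_indep:
  assumes "t \<in> set (law_terms d rels)"
  shows "eval_term I a b t = eval_term I a b' t"
  using assms eval_word_term_indep by (auto simp: law_terms_def)

lemma card_off_diagonal:
  assumes "finite A"
  shows "int (card (A \<times> A - (\<lambda>a. (a, a)) ` A)) = int (card A) * (int (card A) - 1)"
proof -
  have "card (A \<times> A - (\<lambda>a. (a, a)) ` A) = card A * card A - card A"
    using assms by (subst card_Diff_subset)
      (auto simp: card_cartesian_product card_image inj_on_def)
  then show ?thesis
    by (cases "card A") (simp_all add: algebra_simps)
qed

text \<open>The test of \<open>X\<close> against \<open>Y\<close> alone keeps the image off the
  diagonal.\<close>

lemma card_allowed_image_le:
  assumes "finite A"
  shows "int (card (allowed_image d rels w A I)) \<le> int (card A) * (int (card A) - 1)"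
proof -
  have "card (allowed_image d rels w A I) \<le> card (A \<times> A - (\<lambda>a. (a, a)) ` A)"
    using assms by (intro card_mono) (auto simp: allowed_image_def tests_def)
  then show ?thesis
    using card_off_diagonal[OF assms] by linarith
qed

text \<open>The second assumption settles the test on \<open>w\<close>; what remains to be removed
  is the diagonal and, by a union bound, one graph per law term.\<close>

lemma card_allowed_image_ge:
  assumes "finite A" "\<And>a b. a \<in> A \<Longrightarrow> eval_term I a b (word_term w) \<noteq> a"
  shows "int (card A) * (int (card A) - 1) - int (2 * d + length rels) * int (card A)
    \<le> int (card (allowed_image d rels w A I))"
proof -
  \<comment> \<open>Evaluating with \<open>a\<close> in place of \<open>Y\<close> is harmless
    because law terms do not depend on \<open>Y\<close>.\<close>
  define graph where "graph t = (\<lambda>a. (a, eval_term I a a t)) ` A" for t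
  define Bad where "Bad = (\<Union>t \<in> set (law_terms d rels). graph t)"
  have fin: "finite Bad"
    using assms by (simp add: Bad_def graph_def)
  have "card Bad \<le> (\<Sum>t \<in> set (law_terms d rels). card (graph t))"
    unfolding Bad_def by (rule card_UN_le) simp
  also have "\<dots> \<le> (\<Sum>t \<in> set (law_terms d rels). card A)"
    unfolding graph_def by (intro sum_mono card_image_le assms)
  \<comment> \<open>Repeated law terms coincide in the set, hence an inequality.\<close>
  also have "\<dots> \<le> length (law_terms d rels) * card A"
    by (simp add: card_length)
  finally have bad: "card Bad \<le> (2 * d + length rels) * card A"
    by (simp add: length_law_terms)
  have "A \<times> A - (\<lambda>a. (a, a)) ` A - Bad \<subseteq> allowed_image d rels w A I"
  proof
    fix p assume p: "p \<in> A \<times> A - (\<lambda>a. (a, a)) ` A - Bad"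
    then obtain a b where ab: "p = (a, b)" "a \<in> A" "b \<in> A" "a \<noteq> b"
      by auto
    have "eval_term I a b t \<noteq> b" if "t \<in> set (law_terms d rels)" for t
      using p ab that eval_law_term_indep[OF that, of I a b a]
      by (auto simp: Bad_def graph_def)
    then show "p \<in> allowed_image d rels w A I"
      using ab assms(2) by (auto simp: allowed_image_def tests_def)
  qed
  then have "card (A \<times> A - (\<lambda>a. (a, a)) ` A - Bad) \<le> card (allowed_image d rels w A I)"
    using assms(1) by (intro card_mono) (auto simp: allowed_image_def intro: finite_subset[of _ "A \<times> A"])
  moreover have "card (A \<times> A - (\<lambda>a. (a, a)) ` A) - card Bad \<le> card (A \<times> A - (\<lambda>a. (a, a)) ` A - Bad)"
    using fin by (rule diff_card_le_card_Diff)
  ultimately have "int (card (A \<times> A - (\<lambda>a. (a, a)) ` A))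
      \<le> int (card (allowed_image d rels w A I)) + int ((2 * d + length rels) * card A)"
    using bad by linarith
  then show ?thesis
    unfolding card_off_diagonal[OF assms(1)] by simp
qed

section \<open>Bounds and asymptotics of the dispersion\<close>

lemma dispersion_le: "int (dispersion d rels w n) \<le> int n * (int n - 1)"
proof -
  have "dispersion d rels w n \<in> image_sizes d rels w n"
    unfolding dispersion_def by (intro Max_in image_sizes_finite_nonempty)
  then show ?thesis
    unfolding image_sizes_def using card_allowed_image_le by auto
qed

lemma card_le_dispersion:
  assumes "is_interpretation d {..<n} I"
  shows "card (allowed_image d rels w {..<n} I) \<le> dispersion d rels w n"
  unfolding dispersion_def using assms
  by (intro Max_ge image_sizes_finite_nonempty) (auto simp: image_sizes_def intro!: exI[of _ "{..<n}"] exI[of _ I])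

text \<open>Division by \<open>n * (n - 1)\<close> squeezes the ratio between
  \<open>1 - M / (n - 1)\<close> and 1.\<close>

lemma tendsto_dispersion_ratio:
  fixes D :: "nat \<Rightarrow> nat" and M N :: nat
  assumes "\<And>n. N < n \<Longrightarrow> int n * (int n - 1) - int M * int n \<le> int (D n)"
    and "\<And>n. N < n \<Longrightarrow> int (D n) \<le> int n * (int n - 1)"
  shows "(\<lambda>n. real (D n) / (real n * (real n - 1))) \<longlonglongrightarrow> 1"
proof (rule tendsto_sandwich)
  show "\<forall>\<^sub>F n in sequentially. 1 - real M * inverse (real n - 1) \<le> real (D n) / (real n * (real n - 1))"
    \<comment> \<open>Beyond \<open>N\<close> the bounds apply, and beyond 1 the denominator is
      positive.\<close>
    using eventually_gt_at_top[of "max 1 N"]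
  proof eventually_elim
    case (elim n)
    have "real_of_int (int n * (int n - 1) - int M * int n) \<le> real_of_int (int (D n))"
      using assms(1)[of n] elim by (subst of_int_le_iff) simp
    then have "(real n * (real n - 1) - real M * real n) / (real n * (real n - 1))
        \<le> real (D n) / (real n * (real n - 1))"
      using elim by (intro divide_right_mono) auto
    moreover have "(real n * (real n - 1) - real M * real n) / (real n * (real n - 1))
        = 1 - real M * inverse (real n - 1)"
      using elim by (simp add: diff_divide_distrib inverse_eq_divide)
    ultimately show ?case
      by simp
  qed
  show "\<forall>\<^sub>F n in sequentially. real (D n) / (real n * (real n - 1)) \<le> 1"
    using eventually_gt_at_top[of "max 1 N"]
  proof eventually_elim
    case (elim n)
    have "real_of_int (int (D n)) \<le> real_of_int (int n * (int n - 1))"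
      using assms(2)[of n] elim by (subst of_int_le_iff) simp
    then show ?case
      using elim by (simp add: field_simps)
  qed
  have "filterlim (\<lambda>n. real n - 1) at_infinity sequentially"
    using filterlim_tendsto_add_at_top[OF tendsto_const[of "-1"] filterlim_real_sequentially]
    by (intro filterlim_at_top_imp_at_infinity) simp
  then have "(\<lambda>n. inverse (real n - 1)) \<longlonglongrightarrow> 0"
    by (rule filterlim_compose[OF tendsto_inverse_0])
  then have "(\<lambda>n. 1 - real M * inverse (real n - 1)) \<longlonglongrightarrow> 1 - real M * 0"
    by (intro tendsto_intros)
  then show "(\<lambda>n. 1 - real M * inverse (real n - 1)) \<longlonglongrightarrow> 1"
    by simp
qed simp

theorem theorem7p1:
  "\<exists>J. computable_interpretations J \<and>
    (\<forall>(d::nat) (rels :: word list). finite_presentation d rels \<longrightarrow>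
      (let q = length rels; M = 2 * d + q in
        (\<forall>w n. signed_word d w \<and> w \<noteq> [] \<and> length w < n \<longrightarrow>
            int n * (int n - 1) - int M * int n \<le> int (dispersion d rels w n) \<and>
            int (dispersion d rels w n) \<le> int n * (int n - 1) \<and>
            is_interpretation d {..<n} (J d rels w n) \<and>
            (\<forall>s \<in> symbols d. cyclic_shift n (J d rels w n s)) \<and>
            int n * (int n - 1) - int M * int n
              \<le> int (card (allowed_image d rels w {..<n} (J d rels w n)))) \<and>
        (\<forall>w. signed_word d w \<and> w \<noteq> [] \<longrightarrow>
            (\<lambda>n. real (dispersion d rels w n) / (real n * (real n - 1))) \<longlonglongrightarrow> 1) \<and>
        (\<exists>C::real. \<forall>w n. signed_word d w \<and> w \<noteq> [] \<and> length w < n \<longrightarrow>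
            \<bar>(real n)\<^sup>2 - real (dispersion d rels w n)\<bar> \<le> C * real n)))"
proof (intro exI[of _ first_letter_shift] conjI allI impI)
  show "computable_interpretations first_letter_shift"
    by (rule computable_first_letter_shift)
next
  fix d :: nat and rels :: "word list"
  define M where "M = 2 * d + length rels"
  have shift: "cyclic_shift n (first_letter_shift d rels w n s)" for w n s
    unfolding cyclic_shift_def using first_letter_shift_eq by blast
  have interp: "is_interpretation d {..<n} (first_letter_shift d rels w n)" for w n
    by (auto simp: is_interpretation_def first_letter_shift_eq)
  have allowed: "int n * (int n - 1) - int M * int n
      \<le> int (card (allowed_image d rels w {..<n} (first_letter_shift d rels w n)))"
    if "w \<noteq> []" "length w < n" for w n
    using card_allowed_image_ge[of "{..<n}" "first_letter_shift d rels w n" w d rels]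
      word_term_first_letter_shift[OF that] by (simp add: M_def)
  have lower: "int n * (int n - 1) - int M * int n \<le> int (dispersion d rels w n)"
    if "w \<noteq> []" "length w < n" for w n
    using allowed[OF that] card_le_dispersion[of d n "first_letter_shift d rels w n" rels w, OF interp] by linarith
  have limit: "(\<lambda>n. real (dispersion d rels w n) / (real n * (real n - 1))) \<longlonglongrightarrow> 1"
    if "w \<noteq> []" for w
    using lower[OF that] dispersion_le by (rule tendsto_dispersion_ratio)
  \<comment> \<open>The two bounds place \<open>n * n - dispersion d rels w n\<close> between
    \<open>n\<close> and \<open>(M + 1) * n\<close>, so the constant depends on the presentation
    alone.\<close>
  have error: "\<bar>(real n)\<^sup>2 - real (dispersion d rels w n)\<bar> \<le> (real M + 1) * real n"
    if "w \<noteq> []" "length w < n" for w n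
  proof -
    have "real_of_int (int n * (int n - 1) - int M * int n) \<le> real_of_int (int (dispersion d rels w n))"
      using lower[OF that] by (subst of_int_le_iff)
    moreover have "real_of_int (int (dispersion d rels w n)) \<le> real_of_int (int n * (int n - 1))"
      using dispersion_le by (subst of_int_le_iff)
    ultimately show ?thesis
      by (simp add: power2_eq_square algebra_simps)
  qed
  show "let q = length rels; M = 2 * d + q in
        (\<forall>w n. signed_word d w \<and> w \<noteq> [] \<and> length w < n \<longrightarrow>
            int n * (int n - 1) - int M * int n \<le> int (dispersion d rels w n) \<and>
            int (dispersion d rels w n) \<le> int n * (int n - 1) \<and>
            is_interpretation d {..<n} (first_letter_shift d rels w n) \<and>
            (\<forall>s \<in> symbols d. cyclic_shift n (first_letter_shift d rels w n s)) \<and>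
            int n * (int n - 1) - int M * int n
              \<le> int (card (allowed_image d rels w {..<n} (first_letter_shift d rels w n)))) \<and>
        (\<forall>w. signed_word d w \<and> w \<noteq> [] \<longrightarrow>
            (\<lambda>n. real (dispersion d rels w n) / (real n * (real n - 1))) \<longlonglongrightarrow> 1) \<and>
        (\<exists>C::real. \<forall>w n. signed_word d w \<and> w \<noteq> [] \<and> length w < n \<longrightarrow>
            \<bar>(real n)\<^sup>2 - real (dispersion d rels w n)\<bar> \<le> C * real n)"
    unfolding Let_def M_def[symmetric]
    by (intro conjI allI impI ballI exI[of _ "real M + 1"])
      (use lower dispersion_le interp shift allowed limit error in simp_all)
qed

end
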